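(* If $(A,G,\alpha)$ is a free dynamical system, then the induced action $$\sigma:\Gamma_A\times G\to\Gamma_A,\qquad (\chi,g)\mapsto\chi\circ\alpha(g)$$ of $G$ on the spectrum $\Gamma_A$ of $A$ is free.
   Context: Let $\mathbb{K}\in\{\mathbb{R},\mathbb{C}\}$ be the ground field. A dynamical system $(A,G,\alpha)$ consists of a unital locally convex algebra $A$ (jointly continuous multiplication), a topological group $G$ and a group homomorphism $\alpha:G\to\operatorname{Aut}(A)$ such that $G\times A\to A$, $(g,a)\mapsto\alpha(g)(a)$ is continuous. The spectrum $\Gamma_A$ is the set of all nonzero algebra homomorphisms $A\to\mathbb{K}$ (with the topology of pointwise convergence). For a continuous representation $(\pi,V)$ of $G$ (on a locally convex space $V$), let $$\Gamma_AV:=\{s\in A\otimes V:\ (\forall g\in G)\ (\alpha(g)\otimes\operatorname{id}_V)(s)=(\operatorname{id}_A\otimes\pi(g^{-1}))(s)\},$$ where $A\otimes V$ is the (uncompleted) tensor product. A family $(\pi_j,V_j)_{j\in J}$ of continuous representations separates the points of $G$ if for each $g\neq 1_G$ there is $j\in J$ with $\pi_j(g)\neq\operatorname{id}_{V_j}$. A dynamical system $(A,G,\alpha)$ is called free if $A$ is commutative and there exists a family $(\pi_j,V_j)_{j\in J}$ of point separating continuous representations of $G$ such that for all $j\in J$ and all $\chi\in\Gamma_A$ the map $\Gamma_AV_j\to V_j$ given by restricting $\chi\otimes\operatorname{id}_{V_j}$ ($a\otimes v\mapsto\chi(a)v$) is surjective. An action is free if all stabilizers are trivial. *)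

theory Defs
  imports
    "HOL-Analysis.Product_Topology"
    "HOL-Algebra.Module"
    "HOL-Algebra.Group_Action"
    "HOL-Library.Poly_Mapping"
begin

text \<open>
  The ground field is a type \<open>'k\<close> of class \<^class>\<open>real_normed_field\<close>. The norm of such a field is
  multiplicative, so by the theorem of Gelfand and Mazur its instances are, up to isometric
  isomorphism, exactly \<^typ>\<open>real\<close> and \<^typ>\<open>complex\<close>.

  Spaces, algebras and groups are records with explicit carriers, since a family
  \<open>(V\<^sub>j)\<^sub>j\<close> of spaces has to live in one HOL type. No Hausdorff condition is imposed.
\<close>

definition ground_field :: "('k::real_normed_field, 'k) module" where
  "ground_field = \<lparr>carrier = UNIV, monoid.mult = (*), one = 1, zero = 0, add = (+), smult = (*)\<rparr>"


section \<open>Locally convex spaces and algebras, topological groups\<close>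

record ('k, 'v) top_module = "('k, 'v) module" +
  module_topology :: "'v topology"

record 'g top_monoid = "'g monoid" +
  monoid_topology :: "'g topology"

definition convex_in :: "('k::real_normed_field, 'v, 'm) module_scheme \<Rightarrow> 'v set \<Rightarrow> bool" where
  "convex_in V W \<longleftrightarrow> W \<subseteq> carrier V \<and>
     (\<forall>x\<in>W. \<forall>y\<in>W. \<forall>t::real. 0 \<le> t \<and> t \<le> 1 \<longrightarrow>
        (of_real (1 - t) \<odot>\<^bsub>V\<^esub> x) \<oplus>\<^bsub>V\<^esub> (of_real t \<odot>\<^bsub>V\<^esub> y) \<in> W)"

locale locally_convex_space = Module.module "ground_field :: ('k, 'k) module" V
  for V :: "('k::real_normed_field, 'v, 'm) top_module_scheme" (structure) +
  assumes topspace_module: "topspace (module_topology V) = carrier V"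
    and continuous_add:
      "continuous_map (prod_topology (module_topology V) (module_topology V)) (module_topology V)
         (\<lambda>(x, y). x \<oplus>\<^bsub>V\<^esub> y)"
    and continuous_smult:
      "continuous_map (prod_topology euclidean (module_topology V)) (module_topology V)
         (\<lambda>(c, x). c \<odot>\<^bsub>V\<^esub> x)"
    and convex_neighbourhoods:
      "\<lbrakk>openin (module_topology V) U; \<zero>\<^bsub>V\<^esub> \<in> U\<rbrakk> \<Longrightarrow>
         \<exists>W. openin (module_topology V) W \<and> \<zero>\<^bsub>V\<^esub> \<in> W \<and> W \<subseteq> U \<and> convex_in V W"

text \<open>
  The library locale \<^locale>\<open>algebra\<close> covers commutative algebras only, hence both compatibility
  conditions for the multiplication below.
\<close>

locale locally_convex_algebra = locally_convex_space A + ring A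
  for A :: "('k::real_normed_field, 'a, 'm) top_module_scheme" (structure) +
  assumes smult_mult_left:
      "\<lbrakk>x \<in> carrier A; y \<in> carrier A\<rbrakk> \<Longrightarrow> (c \<odot>\<^bsub>A\<^esub> x) \<otimes>\<^bsub>A\<^esub> y = c \<odot>\<^bsub>A\<^esub> (x \<otimes>\<^bsub>A\<^esub> y)"
    and smult_mult_right:
      "\<lbrakk>x \<in> carrier A; y \<in> carrier A\<rbrakk> \<Longrightarrow> x \<otimes>\<^bsub>A\<^esub> (c \<odot>\<^bsub>A\<^esub> y) = c \<odot>\<^bsub>A\<^esub> (x \<otimes>\<^bsub>A\<^esub> y)"
    and continuous_mult:
      "continuous_map (prod_topology (module_topology A) (module_topology A)) (module_topology A)
         (\<lambda>(x, y). x \<otimes>\<^bsub>A\<^esub> y)"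

locale topological_group = group G
  for G :: "('g, 'n) top_monoid_scheme" (structure) +
  assumes topspace_group: "topspace (monoid_topology G) = carrier G"
    and continuous_group_mult:
      "continuous_map (prod_topology (monoid_topology G) (monoid_topology G)) (monoid_topology G)
         (\<lambda>(g, h). g \<otimes>\<^bsub>G\<^esub> h)"
    and continuous_group_inv:
      "continuous_map (monoid_topology G) (monoid_topology G) (\<lambda>g. inv\<^bsub>G\<^esub> g)"


section \<open>Homomorphisms, automorphism groups and the spectrum\<close>

definition linear_maps ::
  "('k, 'v, 'm) module_scheme \<Rightarrow> ('k::real_normed_field, 'w, 'n) module_scheme \<Rightarrow> ('v \<Rightarrow> 'w) set" where
  "linear_maps V W = {f \<in> carrier V \<rightarrow> carrier W.
     (\<forall>x\<in>carrier V. \<forall>y\<in>carrier V. f (x \<oplus>\<^bsub>V\<^esub> y) = f x \<oplus>\<^bsub>W\<^esub> f y) \<and>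
     (\<forall>c. \<forall>x\<in>carrier V. f (c \<odot>\<^bsub>V\<^esub> x) = c \<odot>\<^bsub>W\<^esub> f x)}"

text \<open>Algebra homomorphisms are not required to be unital (or continuous).\<close>

definition algebra_homs ::
  "('k, 'a, 'm) module_scheme \<Rightarrow> ('k::real_normed_field, 'b, 'n) module_scheme \<Rightarrow> ('a \<Rightarrow> 'b) set" where
  "algebra_homs A B = {f \<in> linear_maps A B.
     \<forall>x\<in>carrier A. \<forall>y\<in>carrier A. f (x \<otimes>\<^bsub>A\<^esub> y) = f x \<otimes>\<^bsub>B\<^esub> f y}"

definition GL :: "('k::real_normed_field, 'v, 'm) module_scheme \<Rightarrow> ('v \<Rightarrow> 'v) monoid" where
  "GL V = BijGroup (carrier V) \<lparr>carrier := Bij (carrier V) \<inter> linear_maps V V\<rparr>"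

definition algebra_Aut :: "('k::real_normed_field, 'a, 'm) module_scheme \<Rightarrow> ('a \<Rightarrow> 'a) monoid" where
  "algebra_Aut A = BijGroup (carrier A) \<lparr>carrier := Bij (carrier A) \<inter> algebra_homs A A\<rparr>"

text \<open>As in \<^const>\<open>Bij\<close>, extensionality makes a character a function on the carrier.\<close>

definition spectrum :: "('k::real_normed_field, 'a, 'm) module_scheme \<Rightarrow> ('a \<Rightarrow> 'k) set" where
  "spectrum A = {\<chi> \<in> extensional (carrier A) \<inter> algebra_homs A ground_field.
     \<exists>x\<in>carrier A. \<chi> x \<noteq> 0}"


section \<open>The algebraic tensor product\<close>

text \<open>
  \<open>A \<otimes> V\<close> is the quotient of the space of formal linear combinations of pairs in
  \<open>carrier A \<times> carrier V\<close> by the subspace spanned by the bilinearity relations.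
\<close>

abbreviation formal_scale :: "'k::real_normed_field \<Rightarrow> ('x \<Rightarrow>\<^sub>0 'k) \<Rightarrow> ('x \<Rightarrow>\<^sub>0 'k)" where
  "formal_scale c \<equiv> Poly_Mapping.map ((*) c)"

abbreviation formal :: "'a \<Rightarrow> 'v \<Rightarrow> ('a \<times> 'v) \<Rightarrow>\<^sub>0 'k::real_normed_field" where
  "formal a v \<equiv> Poly_Mapping.single (a, v) 1"

definition formal_combinations ::
  "('k, 'a, 'm) module_scheme \<Rightarrow> ('k::real_normed_field, 'v, 'n) module_scheme \<Rightarrow>
     (('a \<times> 'v) \<Rightarrow>\<^sub>0 'k) set" where
  "formal_combinations A V = {x. Poly_Mapping.keys x \<subseteq> carrier A \<times> carrier V}"

definition bilinear_relations ::
  "('k, 'a, 'm) module_scheme \<Rightarrow> ('k::real_normed_field, 'v, 'n) module_scheme \<Rightarrow>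
     (('a \<times> 'v) \<Rightarrow>\<^sub>0 'k) set" where
  "bilinear_relations A V =
     {formal (a \<oplus>\<^bsub>A\<^esub> b) v - formal a v - formal b v |
        a b v. a \<in> carrier A \<and> b \<in> carrier A \<and> v \<in> carrier V} \<union>
     {formal a (v \<oplus>\<^bsub>V\<^esub> w) - formal a v - formal a w |
        a v w. a \<in> carrier A \<and> v \<in> carrier V \<and> w \<in> carrier V} \<union>
     {formal (c \<odot>\<^bsub>A\<^esub> a) v - formal_scale c (formal a v) |
        c a v. a \<in> carrier A \<and> v \<in> carrier V} \<union>
     {formal a (c \<odot>\<^bsub>V\<^esub> v) - formal_scale c (formal a v) |
        c a v. a \<in> carrier A \<and> v \<in> carrier V}"

definition tensor_rel ::
  "('k, 'a, 'm) module_scheme \<Rightarrow> ('k::real_normed_field, 'v, 'n) module_scheme \<Rightarrow>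
     (('a \<times> 'v) \<Rightarrow>\<^sub>0 'k) rel" where
  "tensor_rel A V = {(x, y). x \<in> formal_combinations A V \<and> y \<in> formal_combinations A V \<and>
     x - y \<in> Modules.module.span formal_scale (bilinear_relations A V)}"

text \<open>The multiplicative part of the \<^const>\<open>ring\<close> record plays no role for a module.\<close>

definition tensor ::
  "('k, 'a, 'm) module_scheme \<Rightarrow> ('k::real_normed_field, 'v, 'n) module_scheme \<Rightarrow>
     ('k, (('a \<times> 'v) \<Rightarrow>\<^sub>0 'k) set) module" where
  "tensor A V = \<lparr>carrier = formal_combinations A V // tensor_rel A V,
     monoid.mult = undefined, one = undefined,
     zero = tensor_rel A V `` {0},
     add = (\<lambda>X Y. \<Union>x\<in>X. \<Union>y\<in>Y. tensor_rel A V `` {x + y}),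
     smult = (\<lambda>c X. \<Union>x\<in>X. tensor_rel A V `` {formal_scale c x})\<rparr>"

definition pure_tensor ::
  "('k, 'a, 'm) module_scheme \<Rightarrow> ('k::real_normed_field, 'v, 'n) module_scheme \<Rightarrow>
     'a \<Rightarrow> 'v \<Rightarrow> (('a \<times> 'v) \<Rightarrow>\<^sub>0 'k) set" where
  "pure_tensor A V a v = tensor_rel A V `` {formal a v}"

text \<open>
  The linear map \<open>A \<otimes> V \<rightarrow> W\<close> with \<open>a \<otimes> v \<mapsto> \<beta> a v\<close>, for a bilinear \<open>\<beta>\<close>: the linear extension of
  \<open>\<beta>\<close> to formal combinations is constant on each class.
\<close>

definition tensor_lift ::
  "('k::real_normed_field, 'w, 'l) module_scheme \<Rightarrow> ('a \<Rightarrow> 'v \<Rightarrow> 'w) \<Rightarrow>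
     (('a \<times> 'v) \<Rightarrow>\<^sub>0 'k) set \<Rightarrow> 'w" where
  "tensor_lift W \<beta> X = the_elem
     ((\<lambda>x. \<Oplus>\<^bsub>W\<^esub>p\<in>Poly_Mapping.keys x. Poly_Mapping.lookup x p \<odot>\<^bsub>W\<^esub> \<beta> (fst p) (snd p)) ` X)"

text \<open>\<open>f \<otimes> g\<close> as a map into \<open>B \<otimes> W\<close>.\<close>

definition tensor_map ::
  "('k, 'b, 'm) module_scheme \<Rightarrow> ('k::real_normed_field, 'w, 'n) module_scheme \<Rightarrow>
     ('a \<Rightarrow> 'b) \<Rightarrow> ('v \<Rightarrow> 'w) \<Rightarrow> (('a \<times> 'v) \<Rightarrow>\<^sub>0 'k) set \<Rightarrow> (('b \<times> 'w) \<Rightarrow>\<^sub>0 'k) set" where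
  "tensor_map B W f g = tensor_lift (tensor B W) (\<lambda>a v. pure_tensor B W (f a) (g v))"

text \<open>\<open>\<chi> \<otimes> id\<^sub>V\<close>, with \<open>\<bbbK> \<otimes> V\<close> identified with \<open>V\<close>.\<close>

definition tensor_eval ::
  "('k::real_normed_field, 'v, 'n) module_scheme \<Rightarrow> ('a \<Rightarrow> 'k) \<Rightarrow>
     (('a \<times> 'v) \<Rightarrow>\<^sub>0 'k) set \<Rightarrow> 'v" where
  "tensor_eval V \<chi> = tensor_lift V (\<lambda>a v. \<chi> a \<odot>\<^bsub>V\<^esub> v)"


section \<open>Dynamical systems and representations\<close>

definition dynamical_system ::
  "('k::real_normed_field, 'a, 'm) top_module_scheme \<Rightarrow> ('g, 'n) top_monoid_scheme \<Rightarrow>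
     ('g \<Rightarrow> 'a \<Rightarrow> 'a) \<Rightarrow> bool" where
  "dynamical_system A G \<alpha> \<longleftrightarrow>
     locally_convex_algebra A \<and> topological_group G \<and> \<alpha> \<in> hom G (algebra_Aut A) \<and>
     continuous_map (prod_topology (monoid_topology G) (module_topology A)) (module_topology A)
       (\<lambda>(g, a). \<alpha> g a)"

definition continuous_representation ::
  "('g, 'n) top_monoid_scheme \<Rightarrow> ('k::real_normed_field, 'v, 'm) top_module_scheme \<Rightarrow>
     ('g \<Rightarrow> 'v \<Rightarrow> 'v) \<Rightarrow> bool" where
  "continuous_representation G V \<pi> \<longleftrightarrow>
     locally_convex_space V \<and> \<pi> \<in> hom G (GL V) \<and>
     continuous_map (prod_topology (monoid_topology G) (module_topology V)) (module_topology V)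
       (\<lambda>(g, v). \<pi> g v)"

definition separates_points ::
  "('g, 'n) monoid_scheme \<Rightarrow> 'j set \<Rightarrow> ('j \<Rightarrow> ('k::real_normed_field, 'v, 'm) module_scheme) \<Rightarrow>
     ('j \<Rightarrow> 'g \<Rightarrow> 'v \<Rightarrow> 'v) \<Rightarrow> bool" where
  "separates_points G J V \<pi> \<longleftrightarrow>
     (\<forall>g\<in>carrier G. g \<noteq> \<one>\<^bsub>G\<^esub> \<longrightarrow> (\<exists>j\<in>J. \<pi> j g \<noteq> (\<lambda>v\<in>carrier (V j). v)))"

text \<open>The space \<open>\<Gamma>\<^sub>A V\<close>.\<close>

definition equivariant_sections ::
  "('k, 'a, 'm) module_scheme \<Rightarrow> ('g, 'n) monoid_scheme \<Rightarrow> ('g \<Rightarrow> 'a \<Rightarrow> 'a) \<Rightarrow>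
     ('k::real_normed_field, 'v, 'l) module_scheme \<Rightarrow> ('g \<Rightarrow> 'v \<Rightarrow> 'v) \<Rightarrow>
     (('a \<times> 'v) \<Rightarrow>\<^sub>0 'k) set set" where
  "equivariant_sections A G \<alpha> V \<pi> = {s \<in> carrier (tensor A V). \<forall>g\<in>carrier G.
     tensor_map A V (\<alpha> g) (\<lambda>v. v) s = tensor_map A V (\<lambda>a. a) (\<pi> (inv\<^bsub>G\<^esub> g)) s}"

text \<open>
  HOL cannot quantify over types inside a formula, so the types \<open>'j\<close> of indices and \<open>'v\<close> of vectors
  over which the family ranges are parameters. In a theorem assuming
  \<open>free_dynamical_system TYPE('j) TYPE('v) A G \<alpha>\<close> for type variables \<open>'j\<close> and \<open>'v\<close>, the family is
  arbitrary: a family of spaces can be transported into any type containing disjoint copies of them.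
\<close>

definition free_dynamical_system ::
  "'j itself \<Rightarrow> 'v itself \<Rightarrow> ('k::real_normed_field, 'a, 'm) top_module_scheme \<Rightarrow>
     ('g, 'n) top_monoid_scheme \<Rightarrow> ('g \<Rightarrow> 'a \<Rightarrow> 'a) \<Rightarrow> bool" where
  "free_dynamical_system _ _ A G \<alpha> \<longleftrightarrow>
     dynamical_system A G \<alpha> \<and>
     (\<forall>x\<in>carrier A. \<forall>y\<in>carrier A. x \<otimes>\<^bsub>A\<^esub> y = y \<otimes>\<^bsub>A\<^esub> x) \<and>
     (\<exists>(J :: 'j set) (V :: 'j \<Rightarrow> ('k, 'v) top_module) \<pi>.
        (\<forall>j\<in>J. continuous_representation G (V j) (\<pi> j)) \<and>
        separates_points G J V \<pi> \<and>
        (\<forall>j\<in>J. \<forall>\<chi>\<in>spectrum A.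
           tensor_eval (V j) \<chi> ` equivariant_sections A G \<alpha> (V j) (\<pi> j) = carrier (V j)))"


section \<open>Free right actions\<close>

definition right_action :: "('g, 'n) monoid_scheme \<Rightarrow> 'x set \<Rightarrow> ('x \<Rightarrow> 'g \<Rightarrow> 'x) \<Rightarrow> bool" where
  "right_action G X \<sigma> \<longleftrightarrow>
     (\<forall>x\<in>X. \<forall>g\<in>carrier G. \<sigma> x g \<in> X) \<and>
     (\<forall>x\<in>X. \<sigma> x \<one>\<^bsub>G\<^esub> = x) \<and>
     (\<forall>x\<in>X. \<forall>g\<in>carrier G. \<forall>h\<in>carrier G. \<sigma> (\<sigma> x g) h = \<sigma> x (g \<otimes>\<^bsub>G\<^esub> h))"

definition free_right_action :: "('g, 'n) monoid_scheme \<Rightarrow> 'x set \<Rightarrow> ('x \<Rightarrow> 'g \<Rightarrow> 'x) \<Rightarrow> bool" where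
  "free_right_action G X \<sigma> \<longleftrightarrow>
     right_action G X \<sigma> \<and> (\<forall>x\<in>X. stabilizer G (\<lambda>g y. \<sigma> y g) x = {\<one>\<^bsub>G\<^esub>})"

text \<open>The map \<open>\<chi> \<circ> \<alpha>(g)\<close> as an extensional function on \<open>carrier A\<close>.\<close>

definition spectrum_action ::
  "('k::real_normed_field, 'a, 'm) module_scheme \<Rightarrow> ('g \<Rightarrow> 'a \<Rightarrow> 'a) \<Rightarrow>
     ('a \<Rightarrow> 'k) \<Rightarrow> 'g \<Rightarrow> 'a \<Rightarrow> 'k" where
  "spectrum_action A \<alpha> \<chi> g = compose (carrier A) \<chi> (\<alpha> g)"

end

theory Submission
  imports Defs
begin

text \<open>
  Suppose that a character \<open>\<chi>\<close> is fixed by \<open>g\<close>, that is, \<open>\<chi> \<circ> \<alpha>(g) = \<chi>\<close>. For a section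
  \<open>s \<in> \<Gamma>\<^sub>A V\<close>, apply \<open>\<chi> \<otimes> id\<close> to both sides of the equation
  \<open>(\<alpha>(g) \<otimes> id)(s) = (id \<otimes> \<pi>(g\<^sup>-\<^sup>1))(s)\<close>. The left side becomes
  \<open>((\<chi> \<circ> \<alpha>(g)) \<otimes> id)(s) = (\<chi> \<otimes> id)(s)\<close> and the right side becomes
  \<open>\<pi>(g\<^sup>-\<^sup>1) ((\<chi> \<otimes> id)(s))\<close>. Hence \<open>\<pi>(g\<^sup>-\<^sup>1)\<close> fixes every value \<open>(\<chi> \<otimes> id)(s)\<close>
  (\<open>equivariant_section_eval_fixed\<close>). In a free system these values exhaust each \<open>V\<^sub>j\<close>, so
  \<open>\<pi>\<^sub>j(g)\<close> is the identity for all \<open>j\<close>, and \<open>g = 1\<close> because the representations separate points.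

  The substance of the argument is the functoriality
  \<open>(\<chi> \<otimes> id) \<circ> (f \<otimes> h) = (\<chi> \<circ> f) \<otimes> h\<close> (\<open>tensor_eval_tensor_map\<close>), which rests on the universal
  property of the tensor product: the linear extension of a bilinear map kills the bilinearity
  relations (\<open>linear_extension_tensor_rel\<close>), so that it descends to the classes of formal
  combinations (\<open>tensor_lift_class\<close>), and linear maps commute with linear extensions
  (\<open>linear_map_linear_extension\<close>).
\<close>


section \<open>Formal linear combinations and bilinear maps\<close>

lemma lookup_formal_scale [simp]:
  "Poly_Mapping.lookup (formal_scale c x) p = c * Poly_Mapping.lookup x p"
  by (simp add: Poly_Mapping.map.rep_eq when_def)

interpretation formal: Modules.module
  "formal_scale :: 'k::real_normed_field \<Rightarrow> ('x \<Rightarrow>\<^sub>0 'k) \<Rightarrow> ('x \<Rightarrow>\<^sub>0 'k)"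
  by unfold_locales (auto intro!: poly_mapping_eqI simp: lookup_add algebra_simps)

lemma keys_formal_scale: "Poly_Mapping.keys (formal_scale c x) \<subseteq> Poly_Mapping.keys x"
  by (auto simp: in_keys_iff)

lemma formal_combinations_subspace:
  "formal.subspace (formal_combinations A V)"
  using keys_formal_scale Poly_Mapping.keys_add
  unfolding formal.subspace_def formal_combinations_def by fastforce

lemmas formal_combinations_closed =
  formal.subspace_0[OF formal_combinations_subspace]
  formal.subspace_add[OF formal_combinations_subspace]
  formal.subspace_diff[OF formal_combinations_subspace]
  formal.subspace_neg[OF formal_combinations_subspace]
  formal.subspace_scale[OF formal_combinations_subspace]

lemma single_in_formal_combinations:
  assumes "a \<in> carrier A" "v \<in> carrier V"
  shows "Poly_Mapping.single (a, v) c \<in> formal_combinations A V"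
  using assms by (auto simp: formal_combinations_def)

lemma formal_combinations_induct [consumes 1, case_names zero add]:
  assumes "x \<in> formal_combinations A V"
    and "P 0"
    and "\<And>a v c x. \<lbrakk>a \<in> carrier A; v \<in> carrier V; x \<in> formal_combinations A V; P x\<rbrakk> \<Longrightarrow>
           P (Poly_Mapping.single (a, v) c + x)"
  shows "P x"
proof -
  have eq: "(\<Sum>p\<in>S. Poly_Mapping.single p (Poly_Mapping.lookup x p)) \<in> formal_combinations A V \<and>
     P (\<Sum>p\<in>S. Poly_Mapping.single p (Poly_Mapping.lookup x p))"
    if "finite S" "S \<subseteq> carrier A \<times> carrier V" for S
    using that
  proof (induction S rule: finite_induct)
    case empty
    then show ?case using assms(2) by (simp add: formal_combinations_closed)
  next
    case (insert p S)
    then show ?case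
      by (cases p) (auto intro!: assms(3) formal_combinations_closed single_in_formal_combinations)
  qed
  have "(\<Sum>p\<in>Poly_Mapping.keys x. Poly_Mapping.single p (Poly_Mapping.lookup x p)) = x"
    by (rule poly_mapping_eqI) (auto simp: lookup_sum lookup_single when_def in_keys_iff)
  then show ?thesis
    using eq[of "Poly_Mapping.keys x"] assms(1) by (auto simp: formal_combinations_def)
qed

definition bilinear_map ::
  "('k, 'a, 'm) module_scheme \<Rightarrow> ('k::real_normed_field, 'v, 'n) module_scheme \<Rightarrow>
     ('k, 'w, 'l) module_scheme \<Rightarrow> ('a \<Rightarrow> 'v \<Rightarrow> 'w) \<Rightarrow> bool" where
  "bilinear_map A V W \<beta> \<longleftrightarrow>
     (\<forall>v\<in>carrier V. (\<lambda>a. \<beta> a v) \<in> linear_maps A W) \<and>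
     (\<forall>a\<in>carrier A. \<beta> a \<in> linear_maps V W)"

text \<open>
  This is the sum that \<^const>\<open>tensor_lift\<close> forms for each representative of a tensor.
\<close>

definition linear_extension ::
  "('k::real_normed_field, 'w, 'l) module_scheme \<Rightarrow> ('a \<Rightarrow> 'v \<Rightarrow> 'w) \<Rightarrow>
     (('a \<times> 'v) \<Rightarrow>\<^sub>0 'k) \<Rightarrow> 'w" where
  "linear_extension W \<beta> x =
     (\<Oplus>\<^bsub>W\<^esub>p\<in>Poly_Mapping.keys x. Poly_Mapping.lookup x p \<odot>\<^bsub>W\<^esub> \<beta> (fst p) (snd p))"

lemma linear_mapsD:
  assumes "f \<in> linear_maps V W"
  shows "x \<in> carrier V \<Longrightarrow> f x \<in> carrier W"
    and "\<lbrakk>x \<in> carrier V; y \<in> carrier V\<rbrakk> \<Longrightarrow> f (x \<oplus>\<^bsub>V\<^esub> y) = f x \<oplus>\<^bsub>W\<^esub> f y"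
    and "x \<in> carrier V \<Longrightarrow> f (c \<odot>\<^bsub>V\<^esub> x) = c \<odot>\<^bsub>W\<^esub> f x"
  using assms by (auto simp: linear_maps_def)

lemma ground_field_simps [simp]:
  "carrier ground_field = UNIV" "\<zero>\<^bsub>ground_field\<^esub> = 0" "\<one>\<^bsub>ground_field\<^esub> = 1"
  "x \<oplus>\<^bsub>ground_field\<^esub> y = x + y" "x \<otimes>\<^bsub>ground_field\<^esub> y = x * y" "x \<odot>\<^bsub>ground_field\<^esub> y = x * y"
  by (simp_all add: ground_field_def)

lemma cring_ground_field: "cring (ground_field :: ('k::real_normed_field, 'k) module)"
proof (rule cringI)
  show "abelian_group (ground_field :: ('k, 'k) module)"
    by (rule abelian_groupI) (auto simp: algebra_simps intro: exI[of _ "- _"] left_minus)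
  show "comm_monoid (ground_field :: ('k, 'k) module)"
    by (rule comm_monoidI) (auto simp: algebra_simps)
qed (auto simp: algebra_simps)

text \<open>
  The algebra, the representation spaces and the tensor products are all modules over
  \<^const>\<open>ground_field\<close>; here the module laws are expressed by the arithmetic of \<open>'k\<close> itself.
\<close>

locale vector_space_record = Module.module "ground_field :: ('k, 'k) module" W
  for W :: "('k::real_normed_field, 'w, 'm) module_scheme" (structure)
begin

lemma scale_closed [simp]: "x \<in> carrier W \<Longrightarrow> c \<odot> x \<in> carrier W"
  using smult_closed[of c x] by simp

lemma scale_add_left: "x \<in> carrier W \<Longrightarrow> (c + d) \<odot> x = c \<odot> x \<oplus> d \<odot> x"
  using smult_l_distr[of c d x] by simp

lemma scale_scale: "x \<in> carrier W \<Longrightarrow> c \<odot> (d \<odot> x) = (c * d) \<odot> x"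
  using smult_assoc1[of c d x] by simp

lemma scale_0 [simp]: "x \<in> carrier W \<Longrightarrow> 0 \<odot> x = \<zero>"
  using smult_l_null[of x] by simp

lemma scale_1 [simp]: "x \<in> carrier W \<Longrightarrow> 1 \<odot> x = x"
  using smult_one[of x] by simp

lemma scale_minus_1: "x \<in> carrier W \<Longrightarrow> (-1) \<odot> x = \<ominus> x"
  using scale_add_left[of x "-1" 1] by (simp add: minus_equality)

lemma linear_extension_0: "linear_extension W \<beta> 0 = \<zero>"
  by (simp add: linear_extension_def)

text \<open>
  On formal combinations the extension of any function \<open>\<beta>\<close> into \<open>W\<close> is linear. The hypothesis
  has bounded quantifiers so that resolution with it determines \<open>A\<close> and \<open>V\<close>, which the
  conclusions do not mention.
\<close>

context
  fixes A :: "('k, 'a, 'n) module_scheme" and V :: "('k, 'v, 'o) module_scheme"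
    and \<beta> :: "'a \<Rightarrow> 'v \<Rightarrow> 'w"
  assumes values_closed: "\<forall>a\<in>carrier A. \<forall>v\<in>carrier V. \<beta> a v \<in> carrier W"
begin

lemmas closed = values_closed[rule_format]

text \<open>
  Two formal combinations have different supports; summing over a common finite superset of them
  makes their linear extensions comparable term by term.
\<close>

lemma linear_extension_superset:
  assumes "finite S" "Poly_Mapping.keys x \<subseteq> S" "S \<subseteq> carrier A \<times> carrier V"
  shows "linear_extension W \<beta> x = (\<Oplus>p\<in>S. Poly_Mapping.lookup x p \<odot> \<beta> (fst p) (snd p))"
  unfolding linear_extension_def
proof (rule add.finprod_mono_neutral_cong_left)
  show "\<And>i. i \<in> S - Poly_Mapping.keys x \<Longrightarrow>
      Poly_Mapping.lookup x i \<odot> \<beta> (fst i) (snd i) = \<zero>"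
    using assms by (auto simp: in_keys_iff intro!: scale_0 closed)
qed (use assms in \<open>auto intro!: scale_closed closed\<close>)

lemma linear_extension_closed:
  assumes "x \<in> formal_combinations A V"
  shows "linear_extension W \<beta> x \<in> carrier W"
  unfolding linear_extension_def
  using assms by (intro finsum_closed) (auto simp: formal_combinations_def intro!: scale_closed closed)

lemma linear_extension_add:
  assumes "x \<in> formal_combinations A V" "y \<in> formal_combinations A V"
  shows "linear_extension W \<beta> (x + y) = linear_extension W \<beta> x \<oplus> linear_extension W \<beta> y"
proof -
  let ?S = "Poly_Mapping.keys x \<union> Poly_Mapping.keys y"
  have S: "finite ?S" "?S \<subseteq> carrier A \<times> carrier V" "Poly_Mapping.keys (x + y) \<subseteq> ?S"
    using assms Poly_Mapping.keys_add[of x y] by (auto simp: formal_combinations_def)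
  have cl: "\<beta> (fst p) (snd p) \<in> carrier W" if "p \<in> ?S" for p
    using that S(2) by (auto intro!: closed)
  have "linear_extension W \<beta> (x + y) =
      (\<Oplus>p\<in>?S. Poly_Mapping.lookup (x + y) p \<odot> \<beta> (fst p) (snd p))"
    by (rule linear_extension_superset) (use S in auto)
  also have "\<dots> = (\<Oplus>p\<in>?S. Poly_Mapping.lookup x p \<odot> \<beta> (fst p) (snd p) \<oplus>
              Poly_Mapping.lookup y p \<odot> \<beta> (fst p) (snd p))"
    by (rule finsum_cong') (use cl in \<open>auto simp: lookup_add scale_add_left\<close>)
  also have "\<dots> = (\<Oplus>p\<in>?S. Poly_Mapping.lookup x p \<odot> \<beta> (fst p) (snd p)) \<oplus>
              (\<Oplus>p\<in>?S. Poly_Mapping.lookup y p \<odot> \<beta> (fst p) (snd p))"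
    using cl by (intro finsum_addf) auto
  also have "\<dots> = linear_extension W \<beta> x \<oplus> linear_extension W \<beta> y"
    using S by (simp add: linear_extension_superset[of ?S])
  finally show ?thesis .
qed

lemma linear_extension_scale:
  assumes "x \<in> formal_combinations A V"
  shows "linear_extension W \<beta> (formal_scale c x) = c \<odot> linear_extension W \<beta> x"
proof -
  let ?S = "Poly_Mapping.keys x"
  have S: "?S \<subseteq> carrier A \<times> carrier V"
    using assms by (auto simp: formal_combinations_def)
  have cl: "\<beta> (fst p) (snd p) \<in> carrier W" if "p \<in> ?S" for p
    using that S by (auto intro!: closed)
  have "linear_extension W \<beta> (formal_scale c x) =
      (\<Oplus>p\<in>?S. c \<odot> (Poly_Mapping.lookup x p \<odot> \<beta> (fst p) (snd p)))"
    using S cl keys_formal_scale[of c x] by (subst linear_extension_superset[of ?S])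
      (auto intro!: finsum_cong' scale_closed simp: scale_scale)
  also have "\<dots> = c \<odot> linear_extension W \<beta> x"
    unfolding linear_extension_def using cl
    by (intro finsum_smult_ldistr[symmetric]) auto
  finally show ?thesis .
qed

lemma linear_extension_single:
  assumes "a \<in> carrier A" "v \<in> carrier V"
  shows "linear_extension W \<beta> (Poly_Mapping.single (a, v) c) = c \<odot> \<beta> a v"
proof -
  have "linear_extension W \<beta> (Poly_Mapping.single (a, v) c) =
      (\<Oplus>p\<in>{(a, v)}. Poly_Mapping.lookup (Poly_Mapping.single (a, v) c) p \<odot> \<beta> (fst p) (snd p))"
    using assms by (intro linear_extension_superset) auto
  also have "\<dots> = c \<odot> \<beta> a v"
    using assms closed by simp
  finally show ?thesis .
qed

lemma linear_extension_cong:
  assumes "x \<in> formal_combinations A V"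
    and "\<And>a v. \<lbrakk>a \<in> carrier A; v \<in> carrier V\<rbrakk> \<Longrightarrow> \<gamma> a v = \<beta> a v"
  shows "linear_extension W \<gamma> x = linear_extension W \<beta> x"
  unfolding linear_extension_def
  by (rule finsum_cong')
    (use assms in \<open>auto simp: formal_combinations_def intro!: scale_closed closed\<close>)

end

end

text \<open>
  A linear extension is a finite sum of scalar multiples of values of \<open>\<beta>\<close>, so \<open>h\<close> passes through it.
  This replaces the composition of maps out of a tensor product by the composition of their values
  on pure tensors.
\<close>

lemma linear_map_linear_extension:
  assumes "vector_space_record W" "vector_space_record W'" "h \<in> linear_maps W W'"
    and closed: "\<forall>a\<in>carrier A. \<forall>v\<in>carrier V. \<beta> a v \<in> carrier W"
    and "x \<in> formal_combinations A V"
  shows "h (linear_extension W \<beta> x) = linear_extension W' (\<lambda>a v. h (\<beta> a v)) x"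
proof -
  interpret W: vector_space_record W by fact
  interpret W': vector_space_record W' by fact
  note h = linear_mapsD[OF assms(3)]
  have closed': "\<forall>a\<in>carrier A. \<forall>v\<in>carrier V. h (\<beta> a v) \<in> carrier W'"
    by (simp add: h closed)
  note ext = W.linear_extension_add[OF closed] W.linear_extension_single[OF closed]
    W.linear_extension_closed[OF closed]
    W'.linear_extension_add[OF closed'] W'.linear_extension_single[OF closed']
  show ?thesis
    using assms(5)
  proof (induction rule: formal_combinations_induct)
    case zero
    \<comment> \<open>Linearity is stated for sums and multiples only; zero is the multiple \<open>0 \<odot> \<zero>\<close>.\<close>
    have "h \<zero>\<^bsub>W\<^esub> = h (0 \<odot>\<^bsub>W\<^esub> \<zero>\<^bsub>W\<^esub>)"
      by simp
    also have "\<dots> = \<zero>\<^bsub>W'\<^esub>"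
      using h(1,3) by (simp del: W.scale_0 W.smult_r_null)
    finally show ?case
      by (simp add: linear_extension_def)
  next
    case (add a v c x)
    then show ?case
      by (simp add: ext single_in_formal_combinations h closed)
  qed
qed


section \<open>The universal property of the tensor product\<close>

lemma equiv_tensor_rel: "equiv (formal_combinations A V) (tensor_rel A V)"
proof (rule equivI)
  show "sym (tensor_rel A V)"
  proof (rule symI)
    show "(y, x) \<in> tensor_rel A V" if "(x, y) \<in> tensor_rel A V" for x y
      using that formal.span_neg[of "x - y" "bilinear_relations A V"]
      by (auto simp: tensor_rel_def)
  qed
  show "trans (tensor_rel A V)"
  proof (rule transI)
    show "(x, z) \<in> tensor_rel A V"
      if "(x, y) \<in> tensor_rel A V" "(y, z) \<in> tensor_rel A V" for x y z
      using that formal.span_add[of "x - y" "bilinear_relations A V" "y - z"]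
      by (auto simp: tensor_rel_def)
  qed
qed (auto simp: tensor_rel_def refl_on_def formal.span_zero)

abbreviation tensor_class ::
  "('k, 'a, 'm) module_scheme \<Rightarrow> ('k::real_normed_field, 'v, 'n) module_scheme \<Rightarrow>
     (('a \<times> 'v) \<Rightarrow>\<^sub>0 'k) \<Rightarrow> (('a \<times> 'v) \<Rightarrow>\<^sub>0 'k) set" where
  "tensor_class A V x \<equiv> tensor_rel A V `` {x}"

lemma tensor_class_eqI: "(x, y) \<in> tensor_rel A V \<Longrightarrow> tensor_class A V x = tensor_class A V y"
  by (rule equiv_class_eq[OF equiv_tensor_rel])

lemma tensor_carrier: "carrier (tensor A V) = tensor_class A V ` formal_combinations A V"
  by (auto simp: tensor_def quotient_def)

lemma tensor_add:
  assumes "x \<in> formal_combinations A V" "y \<in> formal_combinations A V"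
  shows "tensor_class A V x \<oplus>\<^bsub>tensor A V\<^esub> tensor_class A V y = tensor_class A V (x + y)"
proof -
  have "congruent2 (tensor_rel A V) (tensor_rel A V) (\<lambda>x y. tensor_class A V (x + y))"
  proof (rule congruent2I[OF equiv_tensor_rel equiv_tensor_rel])
    show "tensor_class A V (y + z) = tensor_class A V (y' + z)"
      if "z \<in> formal_combinations A V" "(y, y') \<in> tensor_rel A V" for y y' z
      using that by (intro tensor_class_eqI) (auto simp: tensor_rel_def formal_combinations_closed)
    show "tensor_class A V (z + y) = tensor_class A V (z + y')"
      if "z \<in> formal_combinations A V" "(y, y') \<in> tensor_rel A V" for y y' z
      using that by (intro tensor_class_eqI) (auto simp: tensor_rel_def formal_combinations_closed)
  qed
  from UN_equiv_class2[OF equiv_tensor_rel equiv_tensor_rel this assms]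
  show ?thesis
    by (simp add: tensor_def)
qed

lemma tensor_scale:
  assumes "x \<in> formal_combinations A V"
  shows "c \<odot>\<^bsub>tensor A V\<^esub> tensor_class A V x = tensor_class A V (formal_scale c x)"
proof -
  have "congruent (tensor_rel A V) (\<lambda>x. tensor_class A V (formal_scale c x))"
  proof (rule congruentI, rule tensor_class_eqI)
    fix y z assume "(y, z) \<in> tensor_rel A V"
    then show "(formal_scale c y, formal_scale c z) \<in> tensor_rel A V"
      using formal.span_scale[of "y - z" "bilinear_relations A V" c]
      by (auto simp: tensor_rel_def formal_combinations_closed formal.scale_right_diff_distrib)
  qed
  from UN_equiv_class[OF equiv_tensor_rel this assms]
  show ?thesis
    by (simp add: tensor_def)
qed

lemma tensor_zero: "\<zero>\<^bsub>tensor A V\<^esub> = tensor_class A V 0"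
  by (simp add: tensor_def)

text \<open>
  All laws are inherited from formal combinations, since the operations on classes are those on
  representatives.
\<close>

lemma vector_space_record_tensor: "vector_space_record (tensor A V)"
proof -
  have "abelian_group (tensor A V)"
  proof (rule abelian_groupI)
    show "\<exists>Y\<in>carrier (tensor A V). Y \<oplus>\<^bsub>tensor A V\<^esub> X = \<zero>\<^bsub>tensor A V\<^esub>"
      if X: "X \<in> carrier (tensor A V)" for X
    proof -
      obtain x where x: "x \<in> formal_combinations A V" "X = tensor_class A V x"
        using X by (auto simp: tensor_carrier)
      then show ?thesis
        by (intro bexI[of _ "tensor_class A V (- x)"])
          (auto simp: tensor_carrier tensor_add tensor_zero formal_combinations_closed)
    qed
  qed (auto simp: tensor_carrier tensor_add tensor_zero formal_combinations_closed ac_simps)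
  then show ?thesis
    unfolding vector_space_record_def
    by (intro Module.moduleI cring_ground_field)
      (auto simp: tensor_carrier tensor_add tensor_scale formal_combinations_closed
        formal.scale_left_distrib formal.scale_right_distrib)
qed

lemma bilinear_mapD:
  assumes "bilinear_map A V W \<beta>" "a \<in> carrier A" "v \<in> carrier V"
  shows "\<beta> a v \<in> carrier W"
    and "b \<in> carrier A \<Longrightarrow> \<beta> (a \<oplus>\<^bsub>A\<^esub> b) v = \<beta> a v \<oplus>\<^bsub>W\<^esub> \<beta> b v"
    and "w \<in> carrier V \<Longrightarrow> \<beta> a (v \<oplus>\<^bsub>V\<^esub> w) = \<beta> a v \<oplus>\<^bsub>W\<^esub> \<beta> a w"
    and "\<beta> (c \<odot>\<^bsub>A\<^esub> a) v = c \<odot>\<^bsub>W\<^esub> \<beta> a v"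
    and "\<beta> a (c \<odot>\<^bsub>V\<^esub> v) = c \<odot>\<^bsub>W\<^esub> \<beta> a v"
  using assms by (auto simp: bilinear_map_def linear_maps_def)

lemma bilinear_map_closed:
  "bilinear_map A V W \<beta> \<Longrightarrow> \<forall>a\<in>carrier A. \<forall>v\<in>carrier V. \<beta> a v \<in> carrier W"
  by (simp add: bilinear_mapD(1))

locale vector_space_pair = A: vector_space_record A + V: vector_space_record V
  for A :: "('k::real_normed_field, 'a, 'm) module_scheme"
    and V :: "('k, 'v, 'n) module_scheme"
begin

lemma pure_tensor_bilinear: "bilinear_map A V (tensor A V) (pure_tensor A V)"
proof -
  note F = single_in_formal_combinations formal_combinations_closed
  have rel: "tensor_class A V x = tensor_class A V y"
    if "x - y \<in> bilinear_relations A V" "x \<in> formal_combinations A V" "y \<in> formal_combinations A V"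
    for x y
    using that by (intro tensor_class_eqI) (auto simp: tensor_rel_def intro: formal.span_base)
  have "pure_tensor A V (a \<oplus>\<^bsub>A\<^esub> b) v = pure_tensor A V a v \<oplus>\<^bsub>tensor A V\<^esub> pure_tensor A V b v"
    if "a \<in> carrier A" "b \<in> carrier A" "v \<in> carrier V" for a b v
  proof -
    have "formal (a \<oplus>\<^bsub>A\<^esub> b) v - (formal a v + formal b v) \<in> bilinear_relations A V"
      unfolding bilinear_relations_def diff_diff_eq[symmetric] using that by blast
    then show ?thesis
      using that by (simp add: pure_tensor_def tensor_add tensor_scale F rel del: map_single)
  qed
  moreover have "pure_tensor A V a (v \<oplus>\<^bsub>V\<^esub> w) = pure_tensor A V a v \<oplus>\<^bsub>tensor A V\<^esub> pure_tensor A V a w"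
    if "a \<in> carrier A" "v \<in> carrier V" "w \<in> carrier V" for a v w
  proof -
    have "formal a (v \<oplus>\<^bsub>V\<^esub> w) - (formal a v + formal a w) \<in> bilinear_relations A V"
      unfolding bilinear_relations_def diff_diff_eq[symmetric] using that by blast
    then show ?thesis
      using that by (simp add: pure_tensor_def tensor_add tensor_scale F rel del: map_single)
  qed
  moreover have "pure_tensor A V (c \<odot>\<^bsub>A\<^esub> a) v = c \<odot>\<^bsub>tensor A V\<^esub> pure_tensor A V a v"
    if "a \<in> carrier A" "v \<in> carrier V" for c a v
  proof -
    have "formal (c \<odot>\<^bsub>A\<^esub> a) v - formal_scale c (formal a v) \<in> bilinear_relations A V"
      unfolding bilinear_relations_def diff_diff_eq[symmetric] using that by blast
    then show ?thesis
      using that by (simp add: pure_tensor_def tensor_add tensor_scale F rel del: map_single)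
  qed
  moreover have "pure_tensor A V a (c \<odot>\<^bsub>V\<^esub> v) = c \<odot>\<^bsub>tensor A V\<^esub> pure_tensor A V a v"
    if "a \<in> carrier A" "v \<in> carrier V" for c a v
  proof -
    have "formal a (c \<odot>\<^bsub>V\<^esub> v) - formal_scale c (formal a v) \<in> bilinear_relations A V"
      unfolding bilinear_relations_def diff_diff_eq[symmetric] using that by blast
    then show ?thesis
      using that by (simp add: pure_tensor_def tensor_add tensor_scale F rel del: map_single)
  qed
  moreover have "pure_tensor A V a v \<in> carrier (tensor A V)"
    if "a \<in> carrier A" "v \<in> carrier V" for a v
    using that by (auto simp: pure_tensor_def tensor_carrier intro: F)
  ultimately show ?thesis
    by (simp add: bilinear_map_def linear_maps_def)
qed

context
  fixes W :: "('k, 'w, 'l) module_scheme" and \<beta> :: "'a \<Rightarrow> 'v \<Rightarrow> 'w"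
  assumes W: "vector_space_record W" and bil: "bilinear_map A V W \<beta>"
begin

interpretation W: vector_space_record W by (rule W)

lemmas ext_simps =
  W.linear_extension_add[OF bilinear_map_closed[OF bil]]
  W.linear_extension_scale[OF bilinear_map_closed[OF bil]]
  W.linear_extension_single[OF bilinear_map_closed[OF bil]]

text \<open>
  Each bilinearity relation is a difference of two formal combinations that \<open>\<beta>\<close> sends to the same
  vector; this lemma reduces the vanishing of the extension on relations to that equality.
\<close>

lemma linear_extension_diff:
  assumes "x \<in> formal_combinations A V" "y \<in> formal_combinations A V"
    and "linear_extension W \<beta> x = linear_extension W \<beta> y"
  shows "linear_extension W \<beta> (x - y) = \<zero>\<^bsub>W\<^esub>"
proof -
  have "linear_extension W \<beta> (x - y) = linear_extension W \<beta> (x + formal_scale (-1) y)"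
    by simp
  also have "\<dots> = \<zero>\<^bsub>W\<^esub>"
    using assms W.linear_extension_closed[OF bilinear_map_closed[OF bil] assms(2)]
    by (simp add: ext_simps formal_combinations_closed W.scale_minus_1 W.r_neg
        del: formal.scale_minus_left)
  finally show ?thesis .
qed

lemma linear_extension_bilinear_relation:
  assumes "r \<in> bilinear_relations A V"
  shows "r \<in> formal_combinations A V \<and> linear_extension W \<beta> r = \<zero>\<^bsub>W\<^esub>"
proof -
  note F = single_in_formal_combinations formal_combinations_closed
  note simps = ext_simps F bilinear_mapD[OF bil]
  have diff: "x - y \<in> formal_combinations A V \<and> linear_extension W \<beta> (x - y) = \<zero>\<^bsub>W\<^esub>"
    if "x \<in> formal_combinations A V" "y \<in> formal_combinations A V"
      "linear_extension W \<beta> x = linear_extension W \<beta> y" for x y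
    using that linear_extension_diff formal_combinations_closed(3) by blast
  consider
    (add_left) a b v where "a \<in> carrier A" "b \<in> carrier A" "v \<in> carrier V"
      "r = formal (a \<oplus>\<^bsub>A\<^esub> b) v - (formal a v + formal b v)"
  | (add_right) a v w where "a \<in> carrier A" "v \<in> carrier V" "w \<in> carrier V"
      "r = formal a (v \<oplus>\<^bsub>V\<^esub> w) - (formal a v + formal a w)"
  | (scale_left) c a v where "a \<in> carrier A" "v \<in> carrier V"
      "r = formal (c \<odot>\<^bsub>A\<^esub> a) v - formal_scale c (formal a v)"
  | (scale_right) c a v where "a \<in> carrier A" "v \<in> carrier V"
      "r = formal a (c \<odot>\<^bsub>V\<^esub> v) - formal_scale c (formal a v)"
    using assms unfolding bilinear_relations_def diff_diff_eq Un_iff mem_Collect_eq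
    by (elim disjE exE conjE) (rule that, assumption+)+
  then show ?thesis
  proof cases
    case add_left
    show ?thesis unfolding add_left(4) by (rule diff) (use add_left(1-3) in \<open>simp_all add: simps\<close>)
  next
    case add_right
    show ?thesis unfolding add_right(4) by (rule diff) (use add_right(1-3) in \<open>simp_all add: simps\<close>)
  next
    case scale_left
    show ?thesis unfolding scale_left(3)
      by (rule diff) (use scale_left(1-2) in \<open>simp_all add: simps del: map_single\<close>)
  next
    case scale_right
    show ?thesis unfolding scale_right(3)
      by (rule diff) (use scale_right(1-2) in \<open>simp_all add: simps del: map_single\<close>)
  qed
qed

text \<open>
  The formal combinations on which the linear extension vanishes form a subspace. It contains the
  bilinearity relations, hence also their span.
\<close>

lemma linear_extension_tensor_rel:
  assumes "(x, y) \<in> tensor_rel A V"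
  shows "linear_extension W \<beta> x = linear_extension W \<beta> y"
proof -
  let ?N = "{r \<in> formal_combinations A V. linear_extension W \<beta> r = \<zero>\<^bsub>W\<^esub>}"
  have "formal.subspace ?N"
    by (rule formal.subspaceI)
      (simp_all add: formal_combinations_closed ext_simps W.linear_extension_0)
  moreover have "bilinear_relations A V \<subseteq> ?N"
    using linear_extension_bilinear_relation by blast
  ultimately have "formal.span (bilinear_relations A V) \<subseteq> ?N"
    by (intro formal.span_minimal)
  moreover have "x - y \<in> formal.span (bilinear_relations A V)" and y: "y \<in> formal_combinations A V"
    using assms by (simp_all add: tensor_rel_def)
  ultimately have xy: "x - y \<in> formal_combinations A V"
    "linear_extension W \<beta> (x - y) = \<zero>\<^bsub>W\<^esub>"
    by blast+
  \<comment> \<open>\<open>x\<close> differs from \<open>y\<close> by an element of \<open>?N\<close>, so additivity gives the claim.\<close>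
  have "linear_extension W \<beta> (y + (x - y)) = linear_extension W \<beta> y"
    using W.linear_extension_closed[OF bilinear_map_closed[OF bil] y]
    by (simp only: ext_simps(1)[OF y xy(1)] xy(2) W.r_zero)
  then show ?thesis
    by (simp only: add_diff_cancel_left' diff_add_cancel add.commute[of y])
qed

text \<open>
  The extension is constant on the class, so the set of values in \<^const>\<open>tensor_lift\<close> is a singleton
  and \<^const>\<open>the_elem\<close> returns its element.
\<close>

lemma tensor_lift_class:
  assumes "x \<in> formal_combinations A V"
  shows "tensor_lift W \<beta> (tensor_class A V x) = linear_extension W \<beta> x"
proof -
  have "linear_extension W \<beta> ` tensor_class A V x = (\<lambda>_. linear_extension W \<beta> x) ` tensor_class A V x"
    by (rule image_cong[OF refl], rule linear_extension_tensor_rel[symmetric], simp)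
  also have "\<dots> = {linear_extension W \<beta> x}"
    by (rule image_constant[OF equiv_class_self[OF equiv_tensor_rel assms]])
  finally have "linear_extension W \<beta> ` tensor_class A V x = {linear_extension W \<beta> x}" .
  then show ?thesis
    unfolding tensor_lift_def linear_extension_def[symmetric] by simp
qed

lemma tensor_lift_linear: "tensor_lift W \<beta> \<in> linear_maps (tensor A V) W"
  unfolding linear_maps_def
  by (auto simp: tensor_carrier tensor_add tensor_scale tensor_lift_class ext_simps
      formal_combinations_closed intro: W.linear_extension_closed[OF bilinear_map_closed[OF bil]])

lemma tensor_lift_pure:
  assumes "a \<in> carrier A" "v \<in> carrier V"
  shows "tensor_lift W \<beta> (pure_tensor A V a v) = \<beta> a v"
  using assms bilinear_mapD(1)[OF bil assms]
  by (simp add: pure_tensor_def tensor_lift_class single_in_formal_combinations ext_simps)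

end

end

text \<open>
  This is \<open>(\<chi> \<otimes> id) \<circ> (f \<otimes> g) = (\<chi> \<circ> f) \<otimes> g\<close>, evaluated on a representative: the linear map
  \<open>\<chi> \<otimes> id\<close> is moved inside the linear extension that defines \<open>f \<otimes> g\<close>, where it meets only pure
  tensors.
\<close>

lemma tensor_eval_tensor_map:
  assumes "vector_space_record A" "vector_space_record V"
    and "vector_space_record B" "vector_space_record W"
    and f: "f \<in> linear_maps A B" and g: "g \<in> linear_maps V W"
    and \<chi>: "\<chi> \<in> linear_maps B ground_field"
    and x: "x \<in> formal_combinations A V"
  shows "tensor_eval W \<chi> (tensor_map B W f g (tensor_class A V x)) =
    linear_extension W (\<lambda>a v. \<chi> (f a) \<odot>\<^bsub>W\<^esub> g v) x"
proof -
  interpret W: vector_space_record W by fact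
  interpret AV: vector_space_pair A V by (simp add: vector_space_pair_def assms)
  interpret BW: vector_space_pair B W by (simp add: vector_space_pair_def assms)
  note f = linear_mapsD[OF f] and g = linear_mapsD[OF g]
  note pure = bilinear_mapD[OF BW.pure_tensor_bilinear]
  have 1: "bilinear_map A V (tensor B W) (\<lambda>a v. pure_tensor B W (f a) (g v))"
    by (auto simp: bilinear_map_def linear_maps_def f g pure)
  have 2: "bilinear_map B W W (\<lambda>b w. \<chi> b \<odot>\<^bsub>W\<^esub> w)"
    using linear_mapsD[OF \<chi>]
    by (auto simp: bilinear_map_def linear_maps_def W.scale_add_left W.scale_scale
        W.smult_r_distr mult.commute)
  have "tensor_eval W \<chi> (tensor_map B W f g (tensor_class A V x)) =
      tensor_lift W (\<lambda>b w. \<chi> b \<odot>\<^bsub>W\<^esub> w)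
        (linear_extension (tensor B W) (\<lambda>a v. pure_tensor B W (f a) (g v)) x)"
    unfolding tensor_eval_def tensor_map_def
    by (simp add: AV.tensor_lift_class[OF vector_space_record_tensor 1 x])
  also have "\<dots> = linear_extension W
      (\<lambda>a v. tensor_lift W (\<lambda>b w. \<chi> b \<odot>\<^bsub>W\<^esub> w) (pure_tensor B W (f a) (g v))) x"
    by (rule linear_map_linear_extension[OF vector_space_record_tensor assms(4)
          BW.tensor_lift_linear[OF assms(4) 2] bilinear_map_closed[OF 1] x])
  also have "\<dots> = linear_extension W (\<lambda>a v. \<chi> (f a) \<odot>\<^bsub>W\<^esub> g v) x"
    by (rule W.linear_extension_cong[OF _ x])
      (auto simp: BW.tensor_lift_pure[OF assms(4) 2] f g)
  finally show ?thesis .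
qed

lemma tensor_eval_class:
  assumes "vector_space_record A" "vector_space_record V"
    and \<chi>: "\<chi> \<in> linear_maps A ground_field"
    and x: "x \<in> formal_combinations A V"
  shows "tensor_eval V \<chi> (tensor_class A V x) = linear_extension V (\<lambda>a v. \<chi> a \<odot>\<^bsub>V\<^esub> v) x"
proof -
  interpret V: vector_space_record V by fact
  interpret AV: vector_space_pair A V by (simp add: vector_space_pair_def assms)
  have "bilinear_map A V V (\<lambda>a v. \<chi> a \<odot>\<^bsub>V\<^esub> v)"
    using linear_mapsD[OF \<chi>]
    by (auto simp: bilinear_map_def linear_maps_def V.scale_add_left V.scale_scale
        V.smult_r_distr mult.commute)
  from AV.tensor_lift_class[OF assms(2) this x] show ?thesis
    unfolding tensor_eval_def .
qed


section \<open>The action on the spectrum\<close>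

text \<open>
  Applying \<open>\<chi> \<otimes> id\<close> to the equation that defines equivariant sections turns
  \<open>id \<otimes> \<pi>(g\<^sup>-\<^sup>1)\<close> into the action of \<open>\<pi>(g\<^sup>-\<^sup>1)\<close> on the value of \<open>s\<close>, while \<open>\<alpha>(g) \<otimes> id\<close> is
  absorbed by \<open>\<chi>\<close>, which is invariant under \<open>\<alpha>(g)\<close>.
\<close>

lemma equivariant_section_eval_fixed:
  assumes A: "vector_space_record A" and V: "vector_space_record V"
    and \<chi>: "\<chi> \<in> linear_maps A ground_field"
    and \<alpha>: "\<alpha> g \<in> linear_maps A A" and \<pi>: "\<pi> (inv\<^bsub>G\<^esub> g) \<in> linear_maps V V"
    and fixed: "\<And>a. a \<in> carrier A \<Longrightarrow> \<chi> (\<alpha> g a) = \<chi> a"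
    and g: "g \<in> carrier G" and s: "s \<in> equivariant_sections A G \<alpha> V \<pi>"
  shows "\<pi> (inv\<^bsub>G\<^esub> g) (tensor_eval V \<chi> s) = tensor_eval V \<chi> s"
proof -
  interpret V: vector_space_record V by fact
  obtain x where x: "x \<in> formal_combinations A V" and s_eq: "s = tensor_class A V x"
    using s by (auto simp: equivariant_sections_def tensor_carrier)
  have id: "(\<lambda>a. a) \<in> linear_maps A A" "(\<lambda>v. v) \<in> linear_maps V V"
    by (auto simp: linear_maps_def)
  note \<pi>' = linear_mapsD[OF \<pi>]
  have "\<pi> (inv\<^bsub>G\<^esub> g) (tensor_eval V \<chi> s) =
      linear_extension V (\<lambda>a v. \<pi> (inv\<^bsub>G\<^esub> g) (\<chi> a \<odot>\<^bsub>V\<^esub> v)) x"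
    unfolding s_eq tensor_eval_class[OF A V \<chi> x]
    by (rule linear_map_linear_extension[OF V V \<pi> _ x]) simp
  also have "\<dots> = linear_extension V (\<lambda>a v. \<chi> a \<odot>\<^bsub>V\<^esub> \<pi> (inv\<^bsub>G\<^esub> g) v) x"
    by (rule V.linear_extension_cong[OF _ x]) (auto simp: \<pi>')
  also have "\<dots> = tensor_eval V \<chi> (tensor_map A V (\<lambda>a. a) (\<pi> (inv\<^bsub>G\<^esub> g)) s)"
    unfolding s_eq by (rule tensor_eval_tensor_map[OF A V A V id(1) \<pi> \<chi> x, symmetric])
  also have "\<dots> = tensor_eval V \<chi> (tensor_map A V (\<alpha> g) (\<lambda>v. v) s)"
    using s g by (simp add: equivariant_sections_def)
  also have "\<dots> = linear_extension V (\<lambda>a v. \<chi> (\<alpha> g a) \<odot>\<^bsub>V\<^esub> v) x"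
    unfolding s_eq by (rule tensor_eval_tensor_map[OF A V A V \<alpha> id(2) \<chi> x])
  also have "\<dots> = linear_extension V (\<lambda>a v. \<chi> a \<odot>\<^bsub>V\<^esub> v) x"
    by (rule V.linear_extension_cong[OF _ x]) (auto simp: fixed)
  also have "\<dots> = tensor_eval V \<chi> s"
    unfolding s_eq by (rule tensor_eval_class[OF A V \<chi> x, symmetric])
  finally show ?thesis .
qed

text \<open>
  Both \<^const>\<open>GL\<close> and \<^const>\<open>algebra_Aut\<close> are of the form \<open>BijGroup E\<close> with a restricted carrier, so
  homomorphisms into them are group actions in the sense of \<^locale>\<open>group_action\<close>.
\<close>

lemma group_action_of_hom:
  assumes "group G" "\<phi> \<in> hom G (BijGroup E \<lparr>carrier := Bij E \<inter> S\<rparr>)"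
  shows "group_action G E \<phi>" and "g \<in> carrier G \<Longrightarrow> \<phi> g \<in> S"
proof -
  have "\<phi> \<in> hom G (BijGroup E)"
    using assms(2) by (auto simp: hom_def BijGroup_def)
  then show "group_action G E \<phi>"
    using assms(1) group_BijGroup
    by (simp add: group_action_def group_hom_def group_hom_axioms_def)
  show "g \<in> carrier G \<Longrightarrow> \<phi> g \<in> S"
    using assms(2) by (auto simp: hom_def)
qed

text \<open>
  Precomposition reverses the order of composition, so the left action \<open>\<alpha>\<close> on \<open>A\<close> induces a right
  action. A character composed with \<open>\<alpha>(g)\<close> remains nonzero because \<open>\<alpha>(g)\<close> is onto.
\<close>

lemma right_action_spectrum:
  assumes "group G" and A: "vector_space_record A" "Ring.ring A"
    and \<alpha>: "\<alpha> \<in> hom G (algebra_Aut A)"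
  shows "right_action G (spectrum A) (spectrum_action A \<alpha>)"
proof -
  note \<alpha> = group_action_of_hom[OF assms(1) \<alpha>[unfolded algebra_Aut_def]]
  interpret group_action G "carrier A" \<alpha> by (rule \<alpha>(1))
  interpret group G by fact
  interpret A: vector_space_record A by fact
  interpret A: Ring.ring A by fact
  have closed: "\<alpha> g a \<in> carrier A" if "g \<in> carrier G" "a \<in> carrier A" for g a
    using element_image[OF that] by simp
  show ?thesis
    unfolding right_action_def
  proof (intro conjI ballI)
    fix \<chi> g assume \<chi>: "\<chi> \<in> spectrum A" and g: "g \<in> carrier G"
    obtain b where b: "b \<in> carrier A" "\<chi> b \<noteq> 0"
      using \<chi> by (auto simp: spectrum_def)
    from b(1) obtain a where a: "a \<in> carrier A" "\<alpha> g a = b"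
      using surj_prop[OF g] by (metis imageE)
    have "\<alpha> g \<in> algebra_homs A A" "\<chi> \<in> algebra_homs A ground_field"
      using \<chi> \<alpha>(2)[OF g] by (simp_all add: spectrum_def)
    then have "compose (carrier A) \<chi> (\<alpha> g) \<in> algebra_homs A ground_field"
      using A closed[OF g] by (simp add: algebra_homs_def linear_maps_def compose_def)
    with a b show "spectrum_action A \<alpha> \<chi> g \<in> spectrum A"
      by (auto simp: spectrum_def spectrum_action_def compose_def intro!: bexI[of _ a])
  next
    fix \<chi> assume "\<chi> \<in> spectrum A"
    then show "spectrum_action A \<alpha> \<chi> \<one>\<^bsub>G\<^esub> = \<chi>"
      by (auto simp: spectrum_def spectrum_action_def compose_def fun_eq_iff extensional_def
          simp flip: id_eq_one)
  next
    fix \<chi> g h assume "\<chi> \<in> spectrum A" and gh: "g \<in> carrier G" "h \<in> carrier G"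
    then show "spectrum_action A \<alpha> (spectrum_action A \<alpha> \<chi> g) h =
        spectrum_action A \<alpha> \<chi> (g \<otimes>\<^bsub>G\<^esub> h)"
      by (auto simp: spectrum_action_def compose_def fun_eq_iff composition_rule closed)
  qed
qed

theorem theorem6p2p10:
  fixes A :: "('k::real_normed_field, 'a) top_module"
    and G :: "'g top_monoid"
    and \<alpha> :: "'g \<Rightarrow> 'a \<Rightarrow> 'a"
  assumes "free_dynamical_system TYPE('j) TYPE('v) A G \<alpha>"
  shows "free_right_action G (spectrum A) (spectrum_action A \<alpha>)"
proof -
  obtain J :: "'j set" and V :: "'j \<Rightarrow> ('k, 'v) top_module" and \<pi>
    where dyn: "dynamical_system A G \<alpha>"
      and rep: "\<forall>j\<in>J. continuous_representation G (V j) (\<pi> j)"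
      and sep: "separates_points G J V \<pi>"
      and surj: "\<forall>j\<in>J. \<forall>\<chi>\<in>spectrum A.
        tensor_eval (V j) \<chi> ` equivariant_sections A G \<alpha> (V j) (\<pi> j) = carrier (V j)"
    using assms unfolding free_dynamical_system_def
    by (elim conjE exE) (rule that, assumption+)
  have A: "vector_space_record A" "Ring.ring A" and "group G" and \<alpha>: "\<alpha> \<in> hom G (algebra_Aut A)"
    using dyn by (auto simp: dynamical_system_def locally_convex_algebra_def
        locally_convex_space_def vector_space_record_def topological_group_def)
  interpret G: group G by fact
  note \<alpha>_linear = group_action_of_hom(2)[OF \<open>group G\<close> \<alpha>[unfolded algebra_Aut_def]]
  note right = right_action_spectrum[OF \<open>group G\<close> A \<alpha>]
  have "g = \<one>\<^bsub>G\<^esub>"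
    if \<chi>: "\<chi> \<in> spectrum A" and g: "g \<in> carrier G" and stab: "spectrum_action A \<alpha> \<chi> g = \<chi>" for \<chi> g
  proof (rule ccontr)
    assume "g \<noteq> \<one>\<^bsub>G\<^esub>"
    then obtain j where j: "j \<in> J" and moved: "\<pi> j g \<noteq> (\<lambda>v\<in>carrier (V j). v)"
      using sep g by (auto simp: separates_points_def)
    have Vj: "vector_space_record (V j)" and \<pi>: "\<pi> j \<in> hom G (GL (V j))"
      using bspec[OF rep j] by (auto simp: continuous_representation_def locally_convex_space_def
          vector_space_record_def)
    note \<pi>_hom = group_action_of_hom[OF \<open>group G\<close> \<pi>[unfolded GL_def]]
    interpret \<pi>: group_action G "carrier (V j)" "\<pi> j" by (rule \<pi>_hom(1))
    have "\<pi> j g v = v" if v: "v \<in> carrier (V j)" for v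
    proof -
      obtain s where s: "s \<in> equivariant_sections A G \<alpha> (V j) (\<pi> j)"
        and v_eq: "v = tensor_eval (V j) \<chi> s"
        using bspec[OF bspec[OF surj j] \<chi>] v by (metis imageE)
      have "\<pi> j (inv\<^bsub>G\<^esub> g) v = v"
        unfolding v_eq
      proof (rule equivariant_section_eval_fixed[where \<alpha> = \<alpha> and \<pi> = "\<pi> j" and \<chi> = \<chi> and G = G,
            OF A(1) Vj _ _ _ _ g s])
        show "\<chi> (\<alpha> g a) = \<chi> a" if "a \<in> carrier A" for a
          using fun_cong[OF stab, of a] that by (simp add: spectrum_action_def compose_def)
        show "\<chi> \<in> linear_maps A ground_field"
          using \<chi> by (simp add: spectrum_def algebra_homs_def)
        show "\<alpha> g \<in> linear_maps A A"
          using \<alpha>_linear[OF g] by (simp add: algebra_homs_def)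
        show "\<pi> j (inv\<^bsub>G\<^esub> g) \<in> linear_maps (V j) (V j)"
          by (rule \<pi>_hom(2)) (use g in simp)
      qed
      \<comment> \<open>A vector fixed by \<open>\<pi>(g\<^sup>-\<^sup>1)\<close> is fixed by its inverse \<open>\<pi>(g)\<close>.\<close>
      then show ?thesis
        using \<pi>.orbit_sym_aux[of "inv\<^bsub>G\<^esub> g" v v] g v by simp
    qed
    then have "\<pi> j g = (\<lambda>v\<in>carrier (V j). v)"
      using \<pi>.bij_prop0[OF g] by (auto simp: Bij_def extensional_def fun_eq_iff)
    with moved show False ..
  qed
  moreover have "spectrum_action A \<alpha> \<chi> \<one>\<^bsub>G\<^esub> = \<chi>" if "\<chi> \<in> spectrum A" for \<chi>
    using right that by (simp add: right_action_def)
  ultimately show ?thesis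
    using right by (auto simp: free_right_action_def stabilizer_def)
qed

end
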